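(* Let $X$ be a compact metric space and $\varphi:\mathbb{T}^+\times X\to X$ a dynamical system. For $A,R\subset X$ the following statements are equivalent. (i) $(A,R)$ is an attractor-repeller pair for $\varphi$. (ii) $A$ and $R$ are disjoint, compact sets, $A$ is invariant, $R$ is forward invariant, and for every $x\in X\setminus(A\cup R)$ one has $\omega(x)\subset A$, and $\alpha_{\mathrm o}(\gamma_x^-)\subset R$ for every backward orbit $\gamma_x^-$ through $x$.
   Context: $\mathbb{T}$ is $\mathbb{Z}$ or $\mathbb{R}$, $\mathbb{T}^+=\{t\in\mathbb{T}:t\ge0\}$, $\mathbb{T}^-=\{t\in\mathbb{T}:t\le0\}$; time intervals are intervals in $\mathbb{T}$. A dynamical system is a continuous map $\varphi:\mathbb{T}^+\times X\to X$ with $\varphi(0,x)=x$ and $\varphi(t,\varphi(s,x))=\varphi(t+s,x)$ for $s,t\in\mathbb{T}^+$ (no invertibility assumed). $S\subset X$ is invariant if $\varphi(t,S)=S$ for all $t\ge0$, forward invariant if $\varphi(t,S)\subset S$ for all $t\ge0$. $\mathrm{Inv}(U)$ (resp. $\mathrm{Inv}^+(U)$) is the union of all invariant (resp. forward invariant) subsets of $U$. $\omega(x)=\bigcap_{t\ge0}\mathrm{cl}(\{\varphi(s,x):s\ge t\})$. A backward orbit through $x$ is a continuous map $\gamma_x^-:\mathbb{T}^-\to X$ with $\gamma_x^-(0)=x$ and $\gamma_x^-(t+s)=\varphi(s,\gamma_x^-(t))$ whenever $t\le0\le s$ and $t+s\le0$ (it need not exist). Its orbital alpha-limit set is $\alpha_{\mathrm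 o}(\gamma_x^-)=\bigcap_{t\le0}\mathrm{cl}(\gamma_x^-((-\infty,t]))$. A trapping region is a forward invariant $U\subset X$ with $\varphi(\tau,\mathrm{cl}(U))\subset\mathrm{int}(U)$ for some $\tau>0$; an attractor is a set $A=\mathrm{Inv}(U)$ with $U$ a trapping region. The dual repeller of an attractor $A$ is $A^*=\mathrm{Inv}^+(X\setminus U)$, where $U$ is any trapping region with $A=\mathrm{Inv}(U)$ (the set does not depend on the choice of $U$). An attractor-repeller pair is a pair $(A,A^* )$ with $A$ an attractor. *)

theory Defs
  imports "HOL-Analysis.Analysis"
begin

text \<open>
  The time set \<open>T\<close> is a set of reals, to be instantiated with \<open>\<int>\<close> or \<open>UNIV\<close>; \<open>\<int>\<close> inherits the
  discrete topology from the reals. The phase space is a carrier set \<open>X\<close> in a metric space, and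
  closures and interiors are taken in the subspace topology of \<open>X\<close>. Values of a map outside its
  domain are irrelevant.
\<close>

definition nonneg_times :: "real set \<Rightarrow> real set"
  where "nonneg_times T = {t \<in> T. 0 \<le> t}"

definition nonpos_times :: "real set \<Rightarrow> real set"
  where "nonpos_times T = {t \<in> T. t \<le> 0}"

definition dynamical_system ::
    "real set \<Rightarrow> 'a::metric_space set \<Rightarrow> (real \<Rightarrow> 'a \<Rightarrow> 'a) \<Rightarrow> bool"
  where "dynamical_system T X \<phi> \<longleftrightarrow>
    (\<forall>t\<in>nonneg_times T. \<forall>x\<in>X. \<phi> t x \<in> X) \<and>
    continuous_on (nonneg_times T \<times> X) (\<lambda>(t, x). \<phi> t x) \<and>
    (\<forall>x\<in>X. \<phi> 0 x = x) \<and>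
    (\<forall>s\<in>nonneg_times T. \<forall>t\<in>nonneg_times T. \<forall>x\<in>X. \<phi> t (\<phi> s x) = \<phi> (t + s) x)"

definition invariant ::
    "real set \<Rightarrow> 'a set \<Rightarrow> (real \<Rightarrow> 'a \<Rightarrow> 'a) \<Rightarrow> 'a set \<Rightarrow> bool"
  where "invariant T X \<phi> S \<longleftrightarrow> S \<subseteq> X \<and> (\<forall>t\<in>nonneg_times T. \<phi> t ` S = S)"

definition forward_invariant ::
    "real set \<Rightarrow> 'a set \<Rightarrow> (real \<Rightarrow> 'a \<Rightarrow> 'a) \<Rightarrow> 'a set \<Rightarrow> bool"
  where "forward_invariant T X \<phi> S \<longleftrightarrow> S \<subseteq> X \<and> (\<forall>t\<in>nonneg_times T. \<phi> t ` S \<subseteq> S)"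

definition Inv ::
    "real set \<Rightarrow> 'a set \<Rightarrow> (real \<Rightarrow> 'a \<Rightarrow> 'a) \<Rightarrow> 'a set \<Rightarrow> 'a set"
  where "Inv T X \<phi> U = \<Union>{S. S \<subseteq> U \<and> invariant T X \<phi> S}"

definition Inv_plus ::
    "real set \<Rightarrow> 'a set \<Rightarrow> (real \<Rightarrow> 'a \<Rightarrow> 'a) \<Rightarrow> 'a set \<Rightarrow> 'a set"
  where "Inv_plus T X \<phi> U = \<Union>{S. S \<subseteq> U \<and> forward_invariant T X \<phi> S}"

definition omega_limit ::
    "real set \<Rightarrow> 'a::metric_space set \<Rightarrow> (real \<Rightarrow> 'a \<Rightarrow> 'a) \<Rightarrow> 'a \<Rightarrow> 'a set"
  where "omega_limit T X \<phi> x =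
    (\<Inter>t\<in>nonneg_times T. top_of_set X closure_of {\<phi> s x | s. s \<in> T \<and> t \<le> s})"

definition backward_orbit ::
    "real set \<Rightarrow> 'a::metric_space set \<Rightarrow> (real \<Rightarrow> 'a \<Rightarrow> 'a) \<Rightarrow> 'a \<Rightarrow> (real \<Rightarrow> 'a) \<Rightarrow> bool"
  where "backward_orbit T X \<phi> x \<gamma> \<longleftrightarrow>
    (\<forall>t\<in>nonpos_times T. \<gamma> t \<in> X) \<and>
    continuous_on (nonpos_times T) \<gamma> \<and>
    \<gamma> 0 = x \<and>
    (\<forall>t\<in>nonpos_times T. \<forall>s\<in>nonneg_times T. t + s \<le> 0 \<longrightarrow> \<gamma> (t + s) = \<phi> s (\<gamma> t))"

definition orbital_alpha_limit ::
    "real set \<Rightarrow> 'a::metric_space set \<Rightarrow> (real \<Rightarrow> 'a) \<Rightarrow> 'a set"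
  where "orbital_alpha_limit T X \<gamma> =
    (\<Inter>t\<in>nonpos_times T. top_of_set X closure_of (\<gamma> ` {s \<in> T. s \<le> t}))"

definition trapping_region ::
    "real set \<Rightarrow> 'a::metric_space set \<Rightarrow> (real \<Rightarrow> 'a \<Rightarrow> 'a) \<Rightarrow> 'a set \<Rightarrow> bool"
  where "trapping_region T X \<phi> U \<longleftrightarrow>
    forward_invariant T X \<phi> U \<and>
    (\<exists>\<tau>\<in>T. 0 < \<tau> \<and> \<phi> \<tau> ` (top_of_set X closure_of U) \<subseteq> top_of_set X interior_of U)"

definition attractor ::
    "real set \<Rightarrow> 'a::metric_space set \<Rightarrow> (real \<Rightarrow> 'a \<Rightarrow> 'a) \<Rightarrow> 'a set \<Rightarrow> bool"
  where "attractor T X \<phi> A \<longleftrightarrow> (\<exists>U. trapping_region T X \<phi> U \<and> A = Inv T X \<phi> U)"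

text \<open>
  The value does not depend on the chosen trapping region; it is meaningful only if \<open>A\<close> is an
  attractor.
\<close>

definition dual_repeller ::
    "real set \<Rightarrow> 'a::metric_space set \<Rightarrow> (real \<Rightarrow> 'a \<Rightarrow> 'a) \<Rightarrow> 'a set \<Rightarrow> 'a set"
  where "dual_repeller T X \<phi> A =
    Inv_plus T X \<phi> (X - (SOME U. trapping_region T X \<phi> U \<and> A = Inv T X \<phi> U))"

definition attractor_repeller_pair ::
    "real set \<Rightarrow> 'a::metric_space set \<Rightarrow> (real \<Rightarrow> 'a \<Rightarrow> 'a) \<Rightarrow> 'a set \<Rightarrow> 'a set \<Rightarrow> bool"
  where "attractor_repeller_pair T X \<phi> A R \<longleftrightarrow>
    attractor T X \<phi> A \<and> R = dual_repeller T X \<phi> A"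

end

theory Submission
  imports Defs
begin

text \<open>
  If \<open>U\<close> is a trapping region, an invariant set in \<open>closure U\<close> equals its own image under \<open>\<phi> \<tau>\<close> and
  so lies in \<open>Inv U\<close>; this applies to \<open>closure (Inv U)\<close> and to the omega-limit sets of points that
  enter \<open>U\<close>. A backward orbit that stays in \<open>U\<close> lies in \<open>Inv U\<close>, so all others eventually leave \<open>U\<close>
  in backward time.

  Conversely, let \<open>A\<close> and \<open>R\<close> satisfy the limit conditions. A set \<open>S\<close> with \<open>S \<subseteq> \<phi> 1 ` S\<close> whose closure
  misses \<open>R\<close> is contained in \<open>A\<close>, because each of its points has a backward orbit with an alpha-limit
  point outside \<open>R\<close>. Applied to the limits of long orbit segments in a neighbourhood \<open>V\<close> of \<open>A\<close>, this
  shows that \<open>A\<close> is Lyapunov stable. If \<open>closure V\<close> misses \<open>R\<close>, the points whose forward orbits stay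
  in \<open>closure V\<close> are attracted to \<open>A\<close>, uniformly by compactness, and form a trapping region with
  maximal invariant set \<open>A\<close>. Finally \<open>R\<close> is determined by \<open>A\<close>: a point belongs to \<open>R\<close> iff its
  omega-limit set is not contained in \<open>A\<close>.
\<close>

section \<open>Nested sequences of compact sets\<close>

text \<open>Otherwise the closed sets \<open>C n - V\<close> would be nonempty and decreasing in the
  compact space \<open>X\<close>, hence share a point of the intersection outside
  \<open>V\<close>.\<close>

lemma nested_compact_subset_open:
  fixes C :: "nat \<Rightarrow> 'a::metric_space set"
  assumes "compact X" "\<And>n. closed (C n)" "\<And>n. C n \<subseteq> X" "decseq C"
    and "open V" "(\<Inter>n. C n) \<subseteq> V"
  obtains n where "C n \<subseteq> V"
proof (rule ccontr)
  assume "\<not> thesis"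
  then have ne: "C n - V \<noteq> {}" for n
    using that by blast
  have "(\<Inter>n. C n - V) \<noteq> {}"
  proof (rule compact_space_imp_nest)
    show "compact_space (top_of_set X)"
      using assms(1) by (simp add: compact_space_subtopology)
    show "closedin (top_of_set X) (C n - V)" for n
      using assms by (intro closed_subset) (auto simp: closed_Diff)
    show "decseq (\<lambda>n. C n - V)"
      using assms(4) by (auto simp: decseq_def)
  qed (use ne in auto)
  then show False
    using assms(6) by blast
qed

lemma nested_compact_nonempty:
  fixes C :: "nat \<Rightarrow> 'a::metric_space set"
  assumes "compact X" "\<And>n. closed (C n)" "\<And>n. C n \<subseteq> X" "decseq C" "\<And>n. C n \<noteq> {}"
  shows "(\<Inter>n. C n) \<noteq> {}"
  using nested_compact_subset_open[OF assms(1-4), of "{}"] assms(5) by (metis open_empty subset_empty)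

section \<open>Semiflows on a compact space, for both time sets\<close>

locale compact_semiflow =
  fixes T :: "real set" and X :: "'a::metric_space set" and \<phi> :: "real \<Rightarrow> 'a \<Rightarrow> 'a"
  assumes T_cases: "T = \<int> \<or> T = UNIV"
    and compact_X: "compact X"
    and system: "dynamical_system T X \<phi>"
begin

text \<open>Both time sets are closed additive subgroups of the reals containing 1. Working from
  these properties treats discrete and continuous time together.\<close>

lemma T_simps [simp, intro]:
  "0 \<in> T" "1 \<in> T" "real n \<in> T" "s \<in> T \<Longrightarrow> t \<in> T \<Longrightarrow> s + t \<in> T"
  "s \<in> T \<Longrightarrow> t \<in> T \<Longrightarrow> s - t \<in> T" "s \<in> T \<Longrightarrow> - s \<in> T" "closed T"
  using T_cases by auto

lemma closed_X: "closed X"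
  by (rule compact_imp_closed[OF compact_X])

lemma flow_in: "t \<in> T \<Longrightarrow> 0 \<le> t \<Longrightarrow> x \<in> X \<Longrightarrow> \<phi> t x \<in> X"
  and flow_zero: "x \<in> X \<Longrightarrow> \<phi> 0 x = x"
  and flow_add: "\<lbrakk>s \<in> T; 0 \<le> s; t \<in> T; 0 \<le> t; x \<in> X\<rbrakk> \<Longrightarrow> \<phi> t (\<phi> s x) = \<phi> (t + s) x"
  and flow_cont: "continuous_on (nonneg_times T \<times> X) (\<lambda>(t, x). \<phi> t x)"
  using system by (auto simp: dynamical_system_def nonneg_times_def)

lemma flow_split: "\<lbrakk>s \<in> T; 0 \<le> s; t \<in> T; s \<le> t; x \<in> X\<rbrakk> \<Longrightarrow> \<phi> t x = \<phi> (t - s) (\<phi> s x)"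
  by (subst flow_add) auto

lemma continuous_on_flow:
  assumes "continuous_on S f" "continuous_on S g"
    and "\<And>s. s \<in> S \<Longrightarrow> f s \<in> T \<and> 0 \<le> f s \<and> g s \<in> X"
  shows "continuous_on S (\<lambda>s. \<phi> (f s) (g s))"
proof -
  have "(\<lambda>s. (f s, g s)) ` S \<subseteq> nonneg_times T \<times> X"
    using assms(3) by (auto simp: nonneg_times_def)
  from continuous_on_compose2[OF flow_cont continuous_on_Pair[OF assms(1,2)] this]
  show ?thesis by simp
qed

lemma flow_cont_space: "t \<in> T \<Longrightarrow> 0 \<le> t \<Longrightarrow> S \<subseteq> X \<Longrightarrow> continuous_on S (\<phi> t)"
  by (rule continuous_on_flow) auto

lemma closed_flow_vimage:
  assumes "t \<in> T" "0 \<le> t" "closed C"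
  shows "closed {x \<in> X. \<phi> t x \<in> C}"
  using continuous_closed_preimage[OF flow_cont_space[OF assms(1,2) order_refl] closed_X assms(3)]
  by (simp add: vimage_def Int_def)

text \<open>As \<open>X\<close> is closed in the ambient space, relative closures are ambient ones.
  Relative interiors may differ from ambient ones and are handled through ambient open sets.\<close>

lemma closure_of_carrier: "S \<subseteq> X \<Longrightarrow> top_of_set X closure_of S = closure S"
  by (metis closed_X closure_minimal closure_of_subtopology euclidean_closure_of inf.absorb2)

lemma closure_subset_X: "S \<subseteq> X \<Longrightarrow> closure S \<subseteq> X"
  by (simp add: closed_X closure_minimal)

section \<open>Limit sets of sequences of sets: omega-limits, alpha-limits and ends of long orbit
  segments\<close>

lemma limit_set_nonempty:
  assumes "\<And>n. P n \<subseteq> X" "decseq P" "\<And>n::nat. P n \<noteq> {}"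
  shows "(\<Inter>n. closure (P n)) \<noteq> {}"
proof (rule nested_compact_nonempty[OF compact_X])
  show "decseq (\<lambda>n. closure (P n))"
    using assms(2) by (auto simp: decseq_def closure_mono)
qed (use assms closure_subset_X in auto)

lemma limit_set_image_subset:
  assumes "\<And>n. P n \<subseteq> X" "t \<in> T" "0 \<le> t" "\<And>n::nat. \<exists>m. \<phi> t ` P m \<subseteq> P n"
  shows "\<phi> t ` (\<Inter>n. closure (P n)) \<subseteq> (\<Inter>n. closure (P n))"
proof (rule INT_greatest)
  fix n
  obtain m where m: "\<phi> t ` P m \<subseteq> P n" using assms(4) by blast
  have "\<phi> t ` closure (P m) \<subseteq> closure (P n)"
    using m closure_subset[of "P n"] assms
    by (intro image_closure_subset flow_cont_space closure_subset_X) auto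
  then show "\<phi> t ` (\<Inter>n. closure (P n)) \<subseteq> closure (P n)" by blast
qed

text \<open>The image of the compact set \<open>closure (P n)\<close> is closed, so it contains
  \<open>closure (P m)\<close>. Hence a limit point has preimages in every
  \<open>closure (P n)\<close>, and these form nested nonempty compact sets \<open>C n\<close>; a
  common point is a preimage in the limit set.\<close>

lemma limit_set_subset_image:
  assumes "\<And>n. P n \<subseteq> X" "decseq P" "t \<in> T" "0 \<le> t" "\<And>n::nat. \<exists>m. P m \<subseteq> \<phi> t ` P n"
  shows "(\<Inter>n. closure (P n)) \<subseteq> \<phi> t ` (\<Inter>n. closure (P n))"
proof
  fix z assume z: "z \<in> (\<Inter>n. closure (P n))"
  define C where "C n = closure (P n) \<inter> {x \<in> X. \<phi> t x \<in> {z}}" for n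
  have "C n \<noteq> {}" for n
  proof -
    obtain m where "P m \<subseteq> \<phi> t ` P n" using assms(5) by blast
    also have "\<dots> \<subseteq> \<phi> t ` closure (P n)" using closure_subset by blast
    finally have "closure (P m) \<subseteq> \<phi> t ` closure (P n)"
    proof (rule closure_minimal)
      show "closed (\<phi> t ` closure (P n))"
        using assms closure_subset_X compact_X
        by (metis closed_Int_compact closed_closure compact_continuous_image compact_imp_closed
            flow_cont_space inf.absorb1)
    qed
    then obtain y where "y \<in> closure (P n)" "\<phi> t y = z" using z by blast
    then have "y \<in> C n"
      using closure_subset_X[OF assms(1)] by (auto simp: C_def)
    then show ?thesis by blast
  qed
  moreover have "closed (C n)" for n
    unfolding C_def using assms by (intro closed_Int closed_flow_vimage) auto
  moreover have "decseq C"
    unfolding decseq_def C_def using decseqD[OF assms(2)]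
    by (intro allI impI Int_mono closure_mono) auto
  moreover have "C n \<subseteq> X" for n by (auto simp: C_def)
  ultimately have "(\<Inter>n. C n) \<noteq> {}"
    using nested_compact_nonempty[OF compact_X] by blast
  then show "z \<in> \<phi> t ` (\<Inter>n. closure (P n))"
    by (auto simp: C_def)
qed

section \<open>Omega-limit sets\<close>

text \<open>The starting times are natural numbers even in continuous time, so that the results on
  sequences of sets apply.\<close>

definition orbit_tail :: "'a \<Rightarrow> nat \<Rightarrow> 'a set"
  where "orbit_tail x n = {\<phi> s x | s. s \<in> T \<and> real n \<le> s}"

lemma orbit_tail_subset: "x \<in> X \<Longrightarrow> orbit_tail x n \<subseteq> X"
  by (auto simp: orbit_tail_def intro!: flow_in)

lemma decseq_orbit_tail: "decseq (orbit_tail x)"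
  by (force simp: orbit_tail_def decseq_def)

lemma orbit_tail_nonempty: "orbit_tail x n \<noteq> {}"
  by (auto simp: orbit_tail_def)

lemma omega_limit_eq:
  assumes "x \<in> X"
  shows "omega_limit T X \<phi> x = (\<Inter>n. closure (orbit_tail x n))"
proof -
  have *: "top_of_set X closure_of {\<phi> s x | s. s \<in> T \<and> t \<le> s} = closure {\<phi> s x | s. s \<in> T \<and> t \<le> s}"
    if "t \<in> nonneg_times T" for t
    using that assms by (intro closure_of_carrier) (auto simp: nonneg_times_def intro!: flow_in)
  have "closure (orbit_tail x (nat \<lceil>t\<rceil>)) \<subseteq> closure {\<phi> s x | s. s \<in> T \<and> t \<le> s}" for t
    unfolding orbit_tail_def by (intro closure_mono Collect_mono)
      (auto, metis nat_ceiling_le_eq order.trans real_nat_ceiling_ge)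
  moreover have "real n \<in> nonneg_times T" for n by (simp add: nonneg_times_def)
  ultimately show ?thesis
    unfolding omega_limit_def orbit_tail_def using * by fast
qed

lemma omega_limit_nonempty: "x \<in> X \<Longrightarrow> omega_limit T X \<phi> x \<noteq> {}"
  unfolding omega_limit_eq
  by (rule limit_set_nonempty[OF orbit_tail_subset decseq_orbit_tail orbit_tail_nonempty])

text \<open>Flowing for time \<open>t\<close> maps each tail into itself, and every tail starting at
  least \<open>t\<close> later is covered by the image of the earlier one.\<close>

lemma invariant_omega_limit:
  assumes "x \<in> X"
  shows "invariant T X \<phi> (omega_limit T X \<phi> x)"
  unfolding invariant_def
proof (intro conjI ballI equalityI)
  show "omega_limit T X \<phi> x \<subseteq> X"
    unfolding omega_limit_eq[OF assms] using closure_subset_X[OF orbit_tail_subset[OF assms]] by blast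
  fix t assume "t \<in> nonneg_times T"
  then have t: "t \<in> T" "0 \<le> t" by (auto simp: nonneg_times_def)
  have "\<phi> t ` orbit_tail x n \<subseteq> orbit_tail x n" for n
  proof (clarsimp simp: orbit_tail_def)
    fix s assume "s \<in> T" "real n \<le> s"
    then show "\<exists>r. \<phi> t (\<phi> s x) = \<phi> r x \<and> r \<in> T \<and> real n \<le> r"
      using t assms by (intro exI[of _ "t + s"]) (auto simp: flow_add)
  qed
  then show "\<phi> t ` omega_limit T X \<phi> x \<subseteq> omega_limit T X \<phi> x"
    unfolding omega_limit_eq[OF assms]
    by (intro limit_set_image_subset[OF orbit_tail_subset[OF assms] t] exI)
  have "orbit_tail x (n + nat \<lceil>t\<rceil>) \<subseteq> \<phi> t ` orbit_tail x n" for n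
  proof
    fix y assume "y \<in> orbit_tail x (n + nat \<lceil>t\<rceil>)"
    then obtain s where s: "s \<in> T" "real n + real (nat \<lceil>t\<rceil>) \<le> s" "y = \<phi> s x"
      by (auto simp: orbit_tail_def)
    then have "real n \<le> s - t" by linarith
    moreover from this have "y = \<phi> t (\<phi> (s - t) x)"
      using s t assms by (subst flow_add) auto
    ultimately show "y \<in> \<phi> t ` orbit_tail x n"
      using s t by (auto simp: orbit_tail_def)
  qed
  then show "omega_limit T X \<phi> x \<subseteq> \<phi> t ` omega_limit T X \<phi> x"
    unfolding omega_limit_eq[OF assms]
    by (intro limit_set_subset_image[OF orbit_tail_subset[OF assms] decseq_orbit_tail t] exI)
qed

lemma omega_limit_subset_closure:
  assumes "x \<in> X" "forward_invariant T X \<phi> S" "s \<in> T" "0 \<le> s" "\<phi> s x \<in> S"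
  shows "omega_limit T X \<phi> x \<subseteq> closure S"
proof -
  have "orbit_tail x (nat \<lceil>s\<rceil>) \<subseteq> S"
  proof
    fix y assume "y \<in> orbit_tail x (nat \<lceil>s\<rceil>)"
    then obtain t where t: "t \<in> T" "real (nat \<lceil>s\<rceil>) \<le> t" "y = \<phi> t x"
      by (auto simp: orbit_tail_def)
    then have "s \<le> t" by linarith
    then have "y = \<phi> (t - s) (\<phi> s x)" "t - s \<in> nonneg_times T"
      using flow_split[of s t x] assms t by (auto simp: nonneg_times_def)
    then show "y \<in> S" using assms(2,5) unfolding forward_invariant_def by blast
  qed
  then show ?thesis
    unfolding omega_limit_eq[OF assms(1)] using closure_mono by blast
qed

section \<open>Orbital alpha-limit sets\<close>

lemma orbital_alpha_limit_eq:
  assumes "backward_orbit T X \<phi> x \<gamma>"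
  shows "orbital_alpha_limit T X \<gamma> = (\<Inter>n::nat. closure (\<gamma> ` {s \<in> T. s \<le> - real n}))"
proof -
  have *: "top_of_set X closure_of (\<gamma> ` {s \<in> T. s \<le> t}) = closure (\<gamma> ` {s \<in> T. s \<le> t})"
    if "t \<in> nonpos_times T" for t
    using that assms by (intro closure_of_carrier) (auto simp: nonpos_times_def backward_orbit_def)
  have "closure (\<gamma> ` {s \<in> T. s \<le> - real (nat \<lceil>-t\<rceil>)}) \<subseteq> closure (\<gamma> ` {s \<in> T. s \<le> t})" for t
    by (intro closure_mono image_mono Collect_mono) (auto, linarith)
  moreover have "- real n \<in> nonpos_times T" for n by (simp add: nonpos_times_def)
  ultimately show ?thesis
    unfolding orbital_alpha_limit_def using * by fast
qed

lemma backward_orbit_in: "backward_orbit T X \<phi> x \<gamma> \<Longrightarrow> t \<in> T \<Longrightarrow> t \<le> 0 \<Longrightarrow> \<gamma> t \<in> X"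
  by (auto simp: backward_orbit_def nonpos_times_def)

lemma backward_orbit_add:
  "\<lbrakk>backward_orbit T X \<phi> x \<gamma>; t \<in> T; s \<in> T; 0 \<le> s; t + s \<le> 0\<rbrakk> \<Longrightarrow> \<phi> s (\<gamma> t) = \<gamma> (t + s)"
  by (auto simp: backward_orbit_def nonpos_times_def nonneg_times_def)

text \<open>The part of the orbit before \<open>- n - t\<close> is carried by time \<open>t\<close>
  into the part before \<open>- n\<close>; rounding \<open>t\<close> up keeps the indices
  natural.\<close>

lemma forward_invariant_orbital_alpha_limit:
  assumes "backward_orbit T X \<phi> x \<gamma>"
  shows "forward_invariant T X \<phi> (orbital_alpha_limit T X \<gamma>)"
  unfolding forward_invariant_def
proof (intro conjI ballI)
  have sub: "\<gamma> ` {s \<in> T. s \<le> - real n} \<subseteq> X" for n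
    using backward_orbit_in[OF assms] by force
  show "orbital_alpha_limit T X \<gamma> \<subseteq> X"
    unfolding orbital_alpha_limit_eq[OF assms] using closure_subset_X[OF sub] by blast
  fix t assume "t \<in> nonneg_times T"
  then have t: "t \<in> T" "0 \<le> t" by (auto simp: nonneg_times_def)
  have "\<phi> t ` (\<gamma> ` {s \<in> T. s \<le> - real (n + nat \<lceil>t\<rceil>)}) \<subseteq> \<gamma> ` {s \<in> T. s \<le> - real n}" for n
  proof clarsimp
    fix s assume "s \<in> T" "s \<le> - real n - real (nat \<lceil>t\<rceil>)"
    then have "s + t \<le> - real n" "s + t \<in> T" "s + t \<le> 0"
      using t by (linarith, simp, linarith)
    then show "\<phi> t (\<gamma> s) \<in> \<gamma> ` {s \<in> T. s \<le> - real n}"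
      using backward_orbit_add[OF assms \<open>s \<in> T\<close> t] by auto
  qed
  then show "\<phi> t ` orbital_alpha_limit T X \<gamma> \<subseteq> orbital_alpha_limit T X \<gamma>"
    unfolding orbital_alpha_limit_eq[OF assms] by (intro limit_set_image_subset[OF sub t] exI)
qed

section \<open>Largest invariant and forward invariant subsets\<close>

lemma Inv_subset: "Inv T X \<phi> U \<subseteq> U"
  by (auto simp: Inv_def)

lemma Inv_greatest: "S \<subseteq> U \<Longrightarrow> invariant T X \<phi> S \<Longrightarrow> S \<subseteq> Inv T X \<phi> U"
  by (auto simp: Inv_def)

lemma invariant_Inv: "invariant T X \<phi> (Inv T X \<phi> U)"
proof -
  have "\<phi> t ` Inv T X \<phi> U = (\<Union>S\<in>{S. S \<subseteq> U \<and> invariant T X \<phi> S}. \<phi> t ` S)" for t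
    by (auto simp: Inv_def)
  also have "\<dots> t = Inv T X \<phi> U" if "t \<in> nonneg_times T" for t
    using that by (auto simp: Inv_def invariant_def)
  finally show ?thesis
    by (auto simp: invariant_def Inv_def)
qed

lemma Inv_plus_subset: "Inv_plus T X \<phi> U \<subseteq> U"
  by (auto simp: Inv_plus_def)

lemma Inv_plus_greatest: "S \<subseteq> U \<Longrightarrow> forward_invariant T X \<phi> S \<Longrightarrow> S \<subseteq> Inv_plus T X \<phi> U"
  by (auto simp: Inv_plus_def)

lemma forward_invariant_Inv_plus: "forward_invariant T X \<phi> (Inv_plus T X \<phi> U)"
  unfolding Inv_plus_def forward_invariant_def by blast

lemma forward_invariantD: "forward_invariant T X \<phi> S \<Longrightarrow> t \<in> T \<Longrightarrow> 0 \<le> t \<Longrightarrow> x \<in> S \<Longrightarrow> \<phi> t x \<in> S"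
  by (auto simp: forward_invariant_def nonneg_times_def)

lemma invariantD: "invariant T X \<phi> S \<Longrightarrow> t \<in> T \<Longrightarrow> 0 \<le> t \<Longrightarrow> \<phi> t ` S = S"
  by (auto simp: invariant_def nonneg_times_def)

lemma invariant_imp_forward_invariant: "invariant T X \<phi> S \<Longrightarrow> forward_invariant T X \<phi> S"
  by (auto simp: invariant_def forward_invariant_def)

text \<open>By the semigroup law the right-hand side is itself forward invariant. The pointwise form
  lets the repeller be written as an intersection of preimages.\<close>

lemma Inv_plus_eq: "Inv_plus T X \<phi> (X - U) = {x \<in> X. \<forall>t\<in>T. 0 \<le> t \<longrightarrow> \<phi> t x \<notin> U}"
  (is "_ = ?R")
proof
  show "Inv_plus T X \<phi> (X - U) \<subseteq> ?R"
    using forward_invariantD[OF forward_invariant_Inv_plus] Inv_plus_subset[of "X - U"] by blast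
  have "?R \<subseteq> X - U" using flow_zero by fastforce
  moreover have "forward_invariant T X \<phi> ?R"
    by (auto simp: forward_invariant_def nonneg_times_def flow_in flow_add)
  ultimately show "?R \<subseteq> Inv_plus T X \<phi> (X - U)" by (rule Inv_plus_greatest)
qed

text \<open>The backward orbit joined to the forward orbit of \<open>x\<close> is a complete orbit,
  hence an invariant set, and it lies in \<open>U\<close>.\<close>

lemma backward_orbit_in_Inv:
  assumes \<gamma>: "backward_orbit T X \<phi> x \<gamma>" and U: "forward_invariant T X \<phi> U"
    and in_U: "\<And>t. t \<in> T \<Longrightarrow> t \<le> 0 \<Longrightarrow> \<gamma> t \<in> U"
  shows "x \<in> Inv T X \<phi> U"
proof -
  define S where "S = \<gamma> ` {t \<in> T. t \<le> 0} \<union> (\<lambda>t. \<phi> t x) ` {t \<in> T. 0 \<le> t}"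
  have x: "\<gamma> 0 = x" using \<gamma> by (simp add: backward_orbit_def)
  have "x \<in> U" "x \<in> X" using in_U[of 0] U x by (auto simp: forward_invariant_def)
  have end_x: "\<phi> (- s) (\<gamma> s) = x" if "s \<in> T" "s \<le> 0" for s
    using backward_orbit_add[OF \<gamma>, of s "- s"] that x by auto
  have "S \<subseteq> U"
    using in_U forward_invariantD[OF U _ _ \<open>x \<in> U\<close>] by (auto simp: S_def)
  moreover have "invariant T X \<phi> S"
    unfolding invariant_def
  proof (intro conjI ballI equalityI subsetI)
    show "y \<in> S \<Longrightarrow> y \<in> X" for y
      using \<open>S \<subseteq> U\<close> U by (auto simp: forward_invariant_def)
    fix t y assume "t \<in> nonneg_times T"
    then have t: "t \<in> T" "0 \<le> t" by (auto simp: nonneg_times_def)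
    {
      assume "y \<in> \<phi> t ` S"
      then consider s where "s \<in> T" "s \<le> 0" "y = \<phi> t (\<gamma> s)"
        | s where "s \<in> T" "0 \<le> s" "y = \<phi> t (\<phi> s x)"
        by (auto simp: S_def)
      then show "y \<in> S"
      proof cases
        case 1
        show ?thesis
        proof (cases "s + t \<le> 0")
          case True
          then have "y = \<gamma> (s + t)" using backward_orbit_add[OF \<gamma>] 1 t by auto
          then show ?thesis using True 1 t by (auto simp: S_def)
        next
          case False
          \<comment> \<open>The motion crosses time zero: it reaches \<open>x\<close> after time
            \<open>- s\<close> and continues for the remaining \<open>t + s\<close>.\<close>
          then have "y = \<phi> (t - (- s)) (\<phi> (- s) (\<gamma> s))"
            using 1 t flow_split[of "- s" t "\<gamma> s"] backward_orbit_in[OF \<gamma>] by auto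
          then have "y = \<phi> (t + s) x" using end_x 1 by simp
          then show ?thesis using False 1 t by (auto simp: S_def add.commute)
        qed
      next
        case 2
        then show ?thesis using t \<open>x \<in> X\<close> by (auto simp: S_def flow_add)
      qed
    }
    assume "y \<in> S"
    then consider s where "s \<in> T" "s \<le> 0" "y = \<gamma> s" | s where "s \<in> T" "0 \<le> s" "y = \<phi> s x"
      by (auto simp: S_def)
    then show "y \<in> \<phi> t ` S"
    proof cases
      case 1
      then have "y = \<phi> t (\<gamma> (s - t))" using backward_orbit_add[OF \<gamma>, of "s - t" t] t by auto
      then show ?thesis using 1 t by (auto simp: S_def)
    next
      case 2
      show ?thesis
      proof (cases "t \<le> s")
        case True
        then have "y = \<phi> t (\<phi> (s - t) x)"
          using 2 t \<open>x \<in> X\<close> by (subst flow_add) auto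
        then show ?thesis using True 2 t by (auto simp: S_def)
      next
        case False
        \<comment> \<open>The preimage of \<open>\<phi> s x\<close> lies on the backward half: from
          \<open>\<gamma> (s - t)\<close> the motion reaches \<open>x\<close> after
          \<open>t - s\<close> and has time \<open>s\<close> left.\<close>
        then have "\<phi> t (\<gamma> (s - t)) = \<phi> (t - (t - s)) (\<phi> (t - s) (\<gamma> (s - t)))"
          using 2 t backward_orbit_in[OF \<gamma>] by (intro flow_split) auto
        then have "y = \<phi> t (\<gamma> (s - t))"
          using end_x[of "s - t"] False 2 t by simp
        then show ?thesis using False 2 t by (auto simp: S_def)
      qed
    qed
  qed
  moreover have "x \<in> S" using x by (auto simp: S_def)
  ultimately show ?thesis using Inv_greatest by blast
qed

section \<open>From trapping regions to the limit conditions\<close>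

definition separated_by_limits :: "'a set \<Rightarrow> 'a set \<Rightarrow> bool"
  where "separated_by_limits A R \<longleftrightarrow>
    A \<inter> R = {} \<and> compact A \<and> compact R \<and>
    invariant T X \<phi> A \<and> forward_invariant T X \<phi> R \<and>
    (\<forall>x \<in> X - (A \<union> R).
      omega_limit T X \<phi> x \<subseteq> A \<and>
      (\<forall>\<gamma>. backward_orbit T X \<phi> x \<gamma> \<longrightarrow> orbital_alpha_limit T X \<gamma> \<subseteq> R))"

lemma compact_subset_X: "closed S \<Longrightarrow> S \<subseteq> X \<Longrightarrow> compact S"
  by (metis closed_Int_compact compact_X inf.absorb1)

lemma separated_by_limits_trapping_region:
  assumes "trapping_region T X \<phi> U"
  shows "separated_by_limits (Inv T X \<phi> U) (Inv_plus T X \<phi> (X - U))"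
proof -
  define I where "I = top_of_set X interior_of U"
  define A where "A = Inv T X \<phi> U"
  define R where "R = Inv_plus T X \<phi> (X - U)"
  from assms obtain \<tau> where U: "forward_invariant T X \<phi> U"
    and \<tau>: "\<tau> \<in> T" "0 < \<tau>" "\<phi> \<tau> ` (top_of_set X closure_of U) \<subseteq> I"
    unfolding trapping_region_def I_def by blast
  have "U \<subseteq> X" using U by (simp add: forward_invariant_def)
  have \<tau>_I: "\<phi> \<tau> ` closure U \<subseteq> I"
    using \<tau>(3) closure_of_carrier[OF \<open>U \<subseteq> X\<close>] by simp
  have "I \<subseteq> U" unfolding I_def by (rule interior_of_subset)
  \<comment> \<open>An ambient open set with trace \<open>I\<close>, so that avoiding
    \<open>G\<close> is a closed condition.\<close>
  obtain G where G: "open G" "I = X \<inter> G"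
    using openin_interior_of[of "top_of_set X" U] unfolding I_def openin_open by blast
  have absorb: "S \<subseteq> A" if "invariant T X \<phi> S" "S \<subseteq> closure U" for S
  proof -
    have "S = \<phi> \<tau> ` S" using invariantD that(1) \<tau> by force
    also have "\<dots> \<subseteq> U" using \<tau>_I that(2) \<open>I \<subseteq> U\<close> by blast
    finally show ?thesis unfolding A_def using that(1) by (rule Inv_greatest)
  qed
  have A: "invariant T X \<phi> A" "A \<subseteq> U" "A \<subseteq> X"
    unfolding A_def using invariant_Inv Inv_subset \<open>U \<subseteq> X\<close> by blast+
  have "compact A"
  proof -
    have cX: "closure A \<subseteq> X" using A closure_subset_X by blast
    have "invariant T X \<phi> (closure A)"
      unfolding invariant_def
    proof (intro conjI ballI equalityI)
      fix t assume "t \<in> nonneg_times T"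
      then have t: "t \<in> T" "0 \<le> t" by (auto simp: nonneg_times_def)
      have im: "\<phi> t ` A = A" using invariantD A t by blast
      then show "\<phi> t ` closure A \<subseteq> closure A"
        using t cX closure_subset by (intro image_closure_subset flow_cont_space) auto
      have "compact (\<phi> t ` closure A)"
        using t cX by (intro compact_continuous_image flow_cont_space compact_subset_X) auto
      then show "closure A \<subseteq> \<phi> t ` closure A"
        using im closure_subset by (intro closure_minimal compact_imp_closed) blast+
    qed (rule cX)
    then have "closure A \<subseteq> A"
      using A by (intro absorb closure_mono) auto
    then show ?thesis
      using A closure_subset_eq compact_subset_X by blast
  qed
  \<comment> \<open>Never meeting \<open>U\<close> amounts to never meeting \<open>G\<close>,
    because an orbit in \<open>U\<close> is in \<open>G\<close> after a further time
    \<open>\<tau>\<close>. This makes \<open>R\<close> closed although \<open>U\<close> need not be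
    open.\<close>
  have R_eq: "R = (\<Inter>t\<in>{t \<in> T. 0 \<le> t}. {x \<in> X. \<phi> t x \<in> - G})"
  proof -
    have "\<phi> t x \<notin> U" if "x \<in> X" "\<forall>t\<in>T. 0 \<le> t \<longrightarrow> \<phi> t x \<notin> G" "t \<in> T" "0 \<le> t" for t x
    proof
      assume "\<phi> t x \<in> U"
      then have "\<phi> \<tau> (\<phi> t x) \<in> G" using \<tau>_I closure_subset G by blast
      then show False using that \<tau> by (auto simp: flow_add)
    qed
    moreover have "\<phi> t x \<notin> G" if "x \<in> X" "\<forall>t\<in>T. 0 \<le> t \<longrightarrow> \<phi> t x \<notin> U" "t \<in> T" "0 \<le> t" for t x
      using that \<open>I \<subseteq> U\<close> G(2) flow_in by blast
    ultimately show ?thesis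
      unfolding R_def Inv_plus_eq using T_simps(1) by auto
  qed
  have "compact R"
  proof (rule compact_subset_X)
    show "closed R"
      unfolding R_eq using G by (intro closed_INT ballI closed_flow_vimage) auto
    show "R \<subseteq> X" unfolding R_def Inv_plus_eq by blast
  qed
  have "omega_limit T X \<phi> x \<subseteq> A" if x: "x \<in> X" "x \<notin> R" for x
  proof -
    obtain t where "t \<in> T" "0 \<le> t" "\<phi> t x \<in> U"
      using x unfolding R_def Inv_plus_eq by blast
    then show ?thesis
      using x U by (intro absorb invariant_omega_limit omega_limit_subset_closure) auto
  qed
  moreover have "orbital_alpha_limit T X \<gamma> \<subseteq> R"
    if x: "x \<notin> A" and \<gamma>: "backward_orbit T X \<phi> x \<gamma>" for x \<gamma>
  proof -
    obtain t0 where t0: "t0 \<in> T" "t0 \<le> 0" "\<gamma> t0 \<notin> U"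
      using backward_orbit_in_Inv[OF \<gamma> U] x unfolding A_def by blast
    \<comment> \<open>A point of \<open>\<gamma>\<close> in \<open>U\<close> at an earlier time
      would, by forward invariance, put \<open>\<gamma> t0\<close> in \<open>U\<close>.\<close>
    have out: "\<gamma> s \<in> - G" if "s \<in> T" "s \<le> t0" for s
    proof
      assume "\<gamma> s \<in> G"
      then have "\<gamma> s \<in> U"
        using G \<open>I \<subseteq> U\<close> backward_orbit_in[OF \<gamma>, of s] that t0 by auto
      then have "\<phi> (t0 - s) (\<gamma> s) \<in> U"
        using that t0 by (intro forward_invariantD[OF U]) auto
      then show False
        using backward_orbit_add[OF \<gamma>, of s "t0 - s"] that t0 by auto
    qed
    have "closure (\<gamma> ` {s \<in> T. s \<le> - real (nat \<lceil>- t0\<rceil>)}) \<subseteq> - G"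
    proof (rule closure_minimal)
      show "\<gamma> ` {s \<in> T. s \<le> - real (nat \<lceil>- t0\<rceil>)} \<subseteq> - G"
      proof (rule image_subsetI)
        fix s assume "s \<in> {s \<in> T. s \<le> - real (nat \<lceil>- t0\<rceil>)}"
        then have "s \<in> T" "s \<le> - real (nat \<lceil>- t0\<rceil>)" by auto
        moreover from this have "s \<le> t0" by linarith
        ultimately show "\<gamma> s \<in> - G" by (intro out)
      qed
    qed (use G in auto)
    then have "orbital_alpha_limit T X \<gamma> \<subseteq> - G"
      unfolding orbital_alpha_limit_eq[OF \<gamma>] by blast
    \<comment> \<open>The alpha-limit set is forward invariant and misses \<open>G\<close>, so its
      forward orbits never meet \<open>G\<close>; by \<open>R_eq\<close> this places it in
      \<open>R\<close>.\<close>
    then show ?thesis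
      using forward_invariantD[OF forward_invariant_orbital_alpha_limit[OF \<gamma>]]
        forward_invariant_orbital_alpha_limit[OF \<gamma>]
      unfolding R_eq forward_invariant_def by blast
  qed
  moreover have "A \<inter> R = {}"
    using A Inv_plus_subset[of "X - U"] unfolding R_def by blast
  ultimately show ?thesis
    using \<open>compact A\<close> \<open>compact R\<close> A forward_invariant_Inv_plus[of "X - U"]
    unfolding separated_by_limits_def A_def[symmetric] R_def[symmetric] by blast
qed

section \<open>Uniqueness of the repeller\<close>

text \<open>A point of \<open>R\<close> has a nonempty omega-limit set inside \<open>R\<close>,
  hence not inside \<open>A\<close>; the conditions on \<open>R'\<close> then leave only
  \<open>R'\<close> for it. Exchanging the roles gives equality.\<close>

lemma separated_by_limits_repeller_subset:
  assumes "separated_by_limits A R" "separated_by_limits A R'"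
  shows "R \<subseteq> R'"
proof
  fix x assume "x \<in> R"
  have R: "closed R" "forward_invariant T X \<phi> R" "A \<inter> R = {}"
    using assms(1) compact_imp_closed by (auto simp: separated_by_limits_def)
  have "x \<in> X" using R \<open>x \<in> R\<close> by (auto simp: forward_invariant_def)
  then have "omega_limit T X \<phi> x \<subseteq> R"
    using omega_limit_subset_closure[of x R 0] R \<open>x \<in> R\<close> flow_zero by auto
  then have "\<not> omega_limit T X \<phi> x \<subseteq> A"
    using omega_limit_nonempty[OF \<open>x \<in> X\<close>] R by blast
  then show "x \<in> R'"
    using assms(2) \<open>x \<in> X\<close> \<open>x \<in> R\<close> R unfolding separated_by_limits_def by blast
qed

section \<open>Backward orbits and Lyapunov stability\<close>

text \<open>Preimages under the time-one map are chosen successively, and the flow fills in the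
  times between integers.\<close>

lemma backward_orbit_exists:
  assumes S: "S \<subseteq> X" "S \<subseteq> \<phi> 1 ` S" "x \<in> S"
  obtains \<gamma> where "backward_orbit T X \<phi> x \<gamma>" "\<And>n::nat. \<gamma> (- real n) \<in> S"
proof -
  have "\<forall>y\<in>S. \<exists>z. z \<in> S \<and> \<phi> 1 z = y" using S by blast
  then obtain p where p: "\<And>y. y \<in> S \<Longrightarrow> p y \<in> S" "\<And>y. y \<in> S \<Longrightarrow> \<phi> 1 (p y) = y"
    by metis
  define g where "g k = (p ^^ k) x" for k
  have gS: "g k \<in> S" for k
    unfolding g_def by (induction k) (use S p in auto)
  then have gX: "g k \<in> X" for k using S by blast
  have g_step: "\<phi> 1 (g (Suc k)) = g k" for k
    using p gS[of k] by (simp add: g_def)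
  have g_steps: "\<phi> (real m) (g (k + m)) = g k" for m k
  proof (induction m)
    case (Suc m)
    have "\<phi> (real (Suc m)) (g (k + Suc m)) = \<phi> (real m) (\<phi> 1 (g (Suc (k + m))))"
      using gX by (subst flow_add) (auto simp: add.commute)
    then show ?case using Suc g_step by simp
  qed (simp add: flow_zero gX)
  \<comment> \<open>For \<open>t \<le> 0\<close>, go back the least whole number of steps reaching
    time \<open>t\<close> or earlier, then flow forward to \<open>t\<close>. Next it is shown that
    any larger number of steps gives the same point.\<close>
  define \<gamma> where "\<gamma> t = \<phi> (t + real (nat \<lceil>- t\<rceil>)) (g (nat \<lceil>- t\<rceil>))" for t
  have \<gamma>_eq: "\<gamma> t = \<phi> (t + real k) (g k)" if "t \<in> T" "- t \<le> real k" for t k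
  proof -
    define j where "j = nat \<lceil>- t\<rceil>"
    have j: "j \<le> k" "0 \<le> t + real j" using that by (auto simp: j_def) linarith+
    have "\<phi> (t + real k) (g k) = \<phi> (t + real j) (\<phi> (real (k - j)) (g (j + (k - j))))"
      using j that gX by (subst flow_add) (auto simp: of_nat_diff)
    then show ?thesis using g_steps by (simp add: \<gamma>_def j_def)
  qed
  have "\<gamma> (- real n) = g n" for n
    using \<gamma>_eq[of "- real n" n] gX flow_zero by simp
  then have "\<gamma> (- real n) \<in> S" for n using gS by simp
  moreover have "backward_orbit T X \<phi> x \<gamma>"
    unfolding backward_orbit_def
  proof (intro conjI ballI impI)
    fix t assume "t \<in> nonpos_times T"
    then have t: "t \<in> T" "t \<le> 0" by (auto simp: nonpos_times_def)
    obtain k where k: "- t \<le> real k" using real_arch_simple by blast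
    then show "\<gamma> t \<in> X"
      using t gX \<gamma>_eq[OF t(1) k] flow_in[of "t + real k" "g k"] by simp
    fix s assume "s \<in> nonneg_times T" "t + s \<le> 0"
    then have s: "s \<in> T" "0 \<le> s" by (auto simp: nonneg_times_def)
    have "\<gamma> (t + s) = \<phi> (t + s + real k) (g k)"
      using s t k by (intro \<gamma>_eq) auto
    also have "\<dots> = \<phi> s (\<gamma> t)"
      using s t gX k by (subst \<gamma>_eq[OF t(1) k], subst flow_add) (auto simp: algebra_simps)
    finally show "\<gamma> (t + s) = \<phi> s (\<gamma> t)" .
  next
    show "\<gamma> 0 = x" using S flow_zero by (auto simp: \<gamma>_def g_def)
    show "continuous_on (nonpos_times T) \<gamma>"
      unfolding continuous_on_eq_continuous_within
    proof
      fix t assume t: "t \<in> nonpos_times T"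
      \<comment> \<open>The extra 1 makes \<open>- real k < t\<close> strict even at integers, so
        one formula for \<open>\<gamma>\<close> is valid on a whole neighbourhood of
        \<open>t\<close>.\<close>
      define k where "k = nat \<lceil>- t\<rceil> + 1"
      have k: "- real k < t" unfolding k_def by linarith
      define D where "D = nonpos_times T \<inter> {- real k<..}"
      have "continuous_on D (\<lambda>s. \<phi> (s + real k) (g k))"
        using gX by (intro continuous_on_flow continuous_intros) (auto simp: D_def nonpos_times_def)
      then have "continuous_on D \<gamma>"
        by (rule continuous_on_eq) (auto simp: D_def nonpos_times_def intro!: \<gamma>_eq[symmetric])
      moreover have "t \<in> D" using t k by (auto simp: D_def)
      ultimately have "continuous (at t within D) \<gamma>"
        by (simp add: continuous_on_eq_continuous_within)
      moreover have "at t within nonpos_times T = at t within D"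
        using k by (intro at_within_nhd[of _ "{- real k<..}"]) (auto simp: D_def)
      ultimately show "continuous (at t within nonpos_times T) \<gamma>" by simp
    qed
  qed
  ultimately show thesis using that by blast
qed

lemma backward_image_subset_attractor:
  assumes AR: "separated_by_limits A R"
    and S: "S \<subseteq> X" "S \<subseteq> \<phi> 1 ` S" "closure S \<inter> R = {}"
  shows "S \<subseteq> A"
proof
  fix x assume "x \<in> S"
  then obtain \<gamma> where \<gamma>: "backward_orbit T X \<phi> x \<gamma>" and \<gamma>S: "\<And>n::nat. \<gamma> (- real n) \<in> S"
    using backward_orbit_exists S by metis
  \<comment> \<open>Sampling at integer times keeps the points in \<open>S\<close>; an accumulation
    point then lies both in \<open>closure S\<close> and in the alpha-limit set.\<close>
  define P where "P n = (\<lambda>k. \<gamma> (- real k)) ` {n..}" for n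
  have "(\<Inter>n. closure (P n)) \<noteq> {}"
    using \<gamma>S S by (intro limit_set_nonempty) (auto simp: P_def decseq_def)
  then obtain z where z: "\<And>n. z \<in> closure (P n)" by blast
  have "P n \<subseteq> \<gamma> ` {s \<in> T. s \<le> - real n}" for n by (auto simp: P_def)
  then have "z \<in> orbital_alpha_limit T X \<gamma>"
    unfolding orbital_alpha_limit_eq[OF \<gamma>] using z closure_mono by blast
  moreover have "P 0 \<subseteq> S" using \<gamma>S by (auto simp: P_def)
  then have "z \<in> closure S" using z closure_mono by blast
  ultimately have "\<not> orbital_alpha_limit T X \<gamma> \<subseteq> R" using S by blast
  moreover have "x \<in> X" "x \<notin> R" using \<open>x \<in> S\<close> S closure_subset by blast+
  ultimately show "x \<in> A"
    using AR \<gamma> unfolding separated_by_limits_def by blast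
qed

text \<open>The flow is uniformly continuous on the compact set \<open>K \<times> X\<close>, and
  orbits starting in \<open>A\<close> remain in \<open>A\<close>; nearby orbits follow them closely
  up to time \<open>M\<close>.\<close>

lemma stays_near_on_bounded_time:
  assumes A: "compact A" "forward_invariant T X \<phi> A" and V: "open V" "A \<subseteq> V"
  obtains W where "open W" "A \<subseteq> W"
    "\<And>x t. \<lbrakk>x \<in> W \<inter> X; t \<in> T; 0 \<le> t; t \<le> M\<rbrakk> \<Longrightarrow> \<phi> t x \<in> V"
proof -
  obtain e where e: "0 < e" "(\<Union>a\<in>A. ball a e) \<subseteq> V"
    using compact_subset_open_imp_ball_epsilon_subset[OF A(1) V] by blast
  define K where "K = T \<inter> {0..M}"
  have "compact (K \<times> X)"
    unfolding K_def using compact_X by (intro compact_Times closed_Int_compact) auto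
  moreover have "continuous_on (K \<times> X) (\<lambda>(t, x). \<phi> t x)"
    by (rule continuous_on_subset[OF flow_cont]) (auto simp: K_def nonneg_times_def)
  ultimately have "uniformly_continuous_on (K \<times> X) (\<lambda>(t, x). \<phi> t x)"
    using compact_uniformly_continuous by blast
  then obtain d where d: "0 < d"
    "\<And>p q. \<lbrakk>p \<in> K \<times> X; q \<in> K \<times> X; dist q p < d\<rbrakk>
      \<Longrightarrow> dist (case q of (t, x) \<Rightarrow> \<phi> t x) (case p of (t, x) \<Rightarrow> \<phi> t x) < e"
    using e(1) unfolding uniformly_continuous_on_def by blast
  define W where "W = (\<Union>a\<in>A. ball a d)"
  have "\<phi> t x \<in> V" if xt: "x \<in> W \<inter> X" "t \<in> T" "0 \<le> t" "t \<le> M" for x t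
  proof -
    obtain a where a: "a \<in> A" "dist a x < d" using xt by (auto simp: W_def)
    have "a \<in> X" using a A by (auto simp: forward_invariant_def)
    then have "dist (\<phi> t a) (\<phi> t x) < e"
      using d(2)[of "(t, x)" "(t, a)"] a xt by (auto simp: K_def dist_Pair_Pair)
    moreover have "\<phi> t a \<in> A" using forward_invariantD A a xt by blast
    ultimately show ?thesis using e(2) by (metis UN_I mem_ball subsetD)
  qed
  moreover have "open W" "A \<subseteq> W" using d by (auto simp: W_def)
  ultimately show thesis using that by blast
qed

text \<open>Orbit segments that have stayed in \<open>V\<close> long enough end so close to
  \<open>A\<close> that they stay for one more time unit. Induction turns staying for a fixed finite
  time into staying forever.\<close>

lemma attractor_stable:
  assumes AR: "separated_by_limits A R" and V: "open V" "A \<subseteq> V" "closure V \<inter> R = {}"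
  obtains W where "open W" "A \<subseteq> W"
    "\<And>x t. \<lbrakk>x \<in> W \<inter> X; t \<in> T; 0 \<le> t\<rbrakk> \<Longrightarrow> \<phi> t x \<in> V"
proof -
  have A: "compact A" "forward_invariant T X \<phi> A"
    using AR invariant_imp_forward_invariant by (auto simp: separated_by_limits_def)
  define stays where "stays s x \<longleftrightarrow> (\<forall>r\<in>T. 0 \<le> r \<and> r \<le> s \<longrightarrow> \<phi> r x \<in> V)" for s x
  define P where "P m = {\<phi> s x | s x. s \<in> T \<and> real m \<le> s \<and> x \<in> X \<and> stays s x}" for m
  have P: "P m \<subseteq> X" "P m \<subseteq> V" for m
    using flow_in by (auto simp: P_def stays_def)
  have dec: "decseq P" by (force simp: P_def decseq_def)
  \<comment> \<open>Limits of late points of orbit segments in \<open>V\<close> have backward orbits in \<open>closure V\<close>,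
    which avoids \<open>R\<close>.\<close>
  have limits: "(\<Inter>m. closure (P m)) \<subseteq> A"
  proof (rule backward_image_subset_attractor[OF AR])
    show "(\<Inter>m. closure (P m)) \<subseteq> X" using closure_subset_X[OF P(1)] by blast
    have "P (Suc m) \<subseteq> \<phi> 1 ` P m" for m
    proof
      fix y assume "y \<in> P (Suc m)"
      then obtain s x where s: "s \<in> T" "real m + 1 \<le> s" "x \<in> X" "stays s x" "y = \<phi> s x"
        by (auto simp: P_def)
      then have "y = \<phi> 1 (\<phi> (s - 1) x)" by (subst flow_add) auto
      moreover have "\<phi> (s - 1) x \<in> P m"
        unfolding P_def using s by (auto simp: stays_def intro!: exI[of _ "s - 1"] exI[of _ x])
      ultimately show "y \<in> \<phi> 1 ` P m" by blast
    qed
    then show "(\<Inter>m. closure (P m)) \<subseteq> \<phi> 1 ` (\<Inter>m. closure (P m))"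
      by (intro limit_set_subset_image[OF P(1) dec] exI) auto
    have "closure (\<Inter>m. closure (P m)) \<subseteq> closure V"
      using closure_mono[OF P(2)] by (intro closure_minimal) auto
    then show "closure (\<Inter>m. closure (P m)) \<inter> R = {}" using V by blast
  qed
  obtain V1 where V1: "open V1" "A \<subseteq> V1"
    "\<And>x t. \<lbrakk>x \<in> V1 \<inter> X; t \<in> T; 0 \<le> t; t \<le> 1\<rbrakk> \<Longrightarrow> \<phi> t x \<in> V"
    using stays_near_on_bounded_time[OF A V(1,2), of 1] by blast
  have "decseq (\<lambda>m. closure (P m))"
    using dec by (auto simp: decseq_def closure_mono)
  \<comment> \<open>A uniform length: segments in \<open>V\<close> lasting at least \<open>m\<close>
    end in \<open>V1\<close>, where one more unit of time in \<open>V\<close> is guaranteed.\<close>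
  then obtain m where m: "closure (P m) \<subseteq> V1"
    by (rule nested_compact_subset_open[OF compact_X closed_closure closure_subset_X[OF P(1)]
          _ V1(1) order_trans[OF limits V1(2)]])
  have extend: "stays (real (m + k)) x" if "x \<in> X" "stays (real m) x" for x k
  proof (induction k)
    case (Suc k)
    then have "\<phi> (real (m + k)) x \<in> P m"
      unfolding P_def using that by fastforce
    then have y: "\<phi> (real (m + k)) x \<in> V1 \<inter> X"
      using m closure_subset P by blast
    show ?case
      unfolding stays_def
    proof (intro ballI impI)
      fix r assume r: "r \<in> T" "0 \<le> r \<and> r \<le> real (m + Suc k)"
      show "\<phi> r x \<in> V"
      proof (cases "r \<le> real (m + k)")
        case True
        then show ?thesis using Suc r by (auto simp: stays_def)
      next
        case False
        have "\<phi> (r - real (m + k)) (\<phi> (real (m + k)) x) \<in> V"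
          using False r by (intro V1(3)[OF y] T_simps) auto
        then show ?thesis
          using flow_split[of "real (m + k)" r x] False r that(1) by auto
      qed
    qed
  qed (use that in simp)
  \<comment> \<open>Starting in \<open>W\<close> secures the first \<open>m\<close> time units;
    \<open>extend\<close> supplies the rest.\<close>
  obtain W where W: "open W" "A \<subseteq> W"
    "\<And>x t. \<lbrakk>x \<in> W \<inter> X; t \<in> T; 0 \<le> t; t \<le> real m\<rbrakk> \<Longrightarrow> \<phi> t x \<in> V"
    using stays_near_on_bounded_time[OF A V(1,2), of "real m"] by blast
  have "\<phi> t x \<in> V" if "x \<in> W \<inter> X" "t \<in> T" "0 \<le> t" for x t
  proof -
    have "stays (real m) x" using W(3) that by (auto simp: stays_def)
    then have "stays (real (m + nat \<lceil>t\<rceil>)) x" using extend that by blast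
    moreover have "t \<le> real (m + nat \<lceil>t\<rceil>)" by linarith
    ultimately show ?thesis using that by (auto simp: stays_def)
  qed
  then show thesis using that W by blast
qed

section \<open>From the limit conditions to a trapping region\<close>

lemma attractor_if_separated_by_limits:
  assumes AR: "separated_by_limits A R"
  shows "attractor T X \<phi> A"
proof -
  have A: "compact A" "invariant T X \<phi> A" "forward_invariant T X \<phi> A" "A \<subseteq> X"
    and R: "closed R" "A \<inter> R = {}"
    using AR invariant_imp_forward_invariant compact_imp_closed
    by (auto simp: separated_by_limits_def invariant_def)
  obtain e where e: "0 < e" "(\<Union>a\<in>A. ball a e) \<subseteq> - R"
    using compact_subset_open_imp_ball_epsilon_subset[OF A(1), of "- R"] R by blast
  \<comment> \<open>Half the radius keeps even \<open>closure V\<close> within distance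
    \<open>e\<close> of \<open>A\<close>, hence off \<open>R\<close>.\<close>
  define V where "V = (\<Union>a\<in>A. ball a (e/2))"
  have V: "open V" "A \<subseteq> V" using e by (auto simp: V_def)
  have clV: "closure V \<inter> R = {}"
  proof -
    have "y \<notin> R" if y: "y \<in> closure V" for y
    proof -
      obtain v where "v \<in> V" "dist v y < e/2"
        using y e(1) unfolding closure_approachable by (meson half_gt_zero)
      then obtain a where "a \<in> A" "dist a v < e/2" "dist v y < e/2" by (auto simp: V_def)
      then have "a \<in> A" "dist a y < e"
        using dist_triangle[of a y v] by auto
      then show ?thesis using e(2) by (metis ComplD UN_I mem_ball subsetD)
    qed
    then show ?thesis by blast
  qed
  \<comment> \<open>The largest forward invariant subset of \<open>X\<close> inside
    \<open>closure V\<close>; as an intersection of closed preimages it is closed.\<close>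
  define U where "U = {x \<in> X. \<forall>t\<in>T. 0 \<le> t \<longrightarrow> \<phi> t x \<in> closure V}"
  have U: "forward_invariant T X \<phi> U"
    by (auto simp: U_def forward_invariant_def nonneg_times_def flow_in flow_add)
  have "U \<subseteq> X" by (auto simp: U_def)
  have U_clV: "U \<subseteq> closure V" using flow_zero by (force simp: U_def)
  have U_eq: "U = (\<Inter>t\<in>{t \<in> T. 0 \<le> t}. {x \<in> X. \<phi> t x \<in> closure V})"
    using T_simps(1) by (fastforce simp: U_def)
  have clU: "closed U"
    unfolding U_eq by (intro closed_INT ballI closed_flow_vimage) auto
  obtain W where W: "open W" "A \<subseteq> W"
    "\<And>x t. \<lbrakk>x \<in> W \<inter> X; t \<in> T; 0 \<le> t\<rbrakk> \<Longrightarrow> \<phi> t x \<in> V"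
    using attractor_stable[OF AR V clV] by blast
  have WU: "W \<inter> X \<subseteq> U"
    using W closure_subset by (force simp: U_def)
  \<comment> \<open>A second use of stability: an orbit that enters \<open>W'\<close> remains in
    \<open>W\<close>, and \<open>W \<inter> X\<close> is a relatively open subset of
    \<open>U\<close>.\<close>
  obtain W' where W': "open W'" "A \<subseteq> W'"
    "\<And>x t. \<lbrakk>x \<in> W' \<inter> X; t \<in> T; 0 \<le> t\<rbrakk> \<Longrightarrow> \<phi> t x \<in> W \<inter> V"
  proof (rule attractor_stable[OF AR])
    show "open (W \<inter> V)" "A \<subseteq> W \<inter> V" using W V by auto
    show "closure (W \<inter> V) \<inter> R = {}" using clV closure_mono[of "W \<inter> V" V] by blast
  qed blast
  \<comment> \<open>Points of \<open>U\<close> whose orbits avoid \<open>W'\<close> up to time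
    \<open>n\<close>. These closed sets decrease to the empty set, so one of them is empty, which
    bounds the entry time into \<open>W'\<close> uniformly.\<close>
  define C where "C n = U \<inter> (\<Inter>s\<in>{s \<in> T. 0 \<le> s \<and> s \<le> real n}. {x \<in> X. \<phi> s x \<in> - W'})" for n
  have reach: "\<exists>s\<in>T. 0 \<le> s \<and> \<phi> s x \<in> W'" if "x \<in> U" for x
  proof (cases "x \<in> A")
    case True
    then have "\<phi> 0 x \<in> W'" using W'(2) A(4) by (metis flow_zero subsetD)
    then show ?thesis by (intro bexI[of _ 0]) auto
  next
    case False
    have x: "x \<in> X" "x \<notin> R" using that \<open>U \<subseteq> X\<close> U_clV clV by auto
    then have "omega_limit T X \<phi> x \<subseteq> A"
      using AR False unfolding separated_by_limits_def by blast
    then obtain y where "y \<in> W'" "y \<in> omega_limit T X \<phi> x"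
      using omega_limit_nonempty[OF x(1)] W' by blast
    then have "W' \<inter> closure (orbit_tail x 0) \<noteq> {}"
      using x omega_limit_eq by blast
    then have "W' \<inter> orbit_tail x 0 \<noteq> {}"
      using W'(1) open_Int_closure_eq_empty by blast
    then show ?thesis by (auto simp: orbit_tail_def)
  qed
  have "closed (C n)" for n
    unfolding C_def using clU W'(1) by (intro closed_Int closed_INT ballI closed_flow_vimage) auto
  moreover have "decseq C" by (force simp: C_def decseq_def)
  moreover have "C n \<subseteq> X" for n using \<open>U \<subseteq> X\<close> by (auto simp: C_def)
  moreover have "(\<Inter>n. C n) \<subseteq> {}"
  proof
    fix x assume x: "x \<in> (\<Inter>n. C n)"
    then have "x \<in> U" by (auto simp: C_def)
    then obtain s where s: "s \<in> T" "0 \<le> s" "\<phi> s x \<in> W'"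
      using reach by blast
    obtain k where "s \<le> real k" using real_arch_simple by blast
    moreover have "x \<in> C k" using x by blast
    ultimately show "x \<in> {}" using s by (auto simp: C_def)
  qed
  ultimately obtain n where n: "C n \<subseteq> {}"
    using nested_compact_subset_open[OF compact_X, of C "{}"] by blast
  \<comment> \<open>The additional 1 makes the trapping time positive when \<open>n\<close> is
    0.\<close>
  have "\<phi> (real n + 1) x \<in> W \<inter> X" if x: "x \<in> U" for x
  proof -
    have "x \<in> X" using x \<open>U \<subseteq> X\<close> by blast
    moreover have "x \<notin> C n" using n by blast
    ultimately obtain s where s: "s \<in> T" "0 \<le> s" "s \<le> real n" "\<phi> s x \<in> W'"
      unfolding C_def using x by blast
    then have "\<phi> (real n + 1) x = \<phi> (real n + 1 - s) (\<phi> s x)"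
      using \<open>x \<in> X\<close> by (intro flow_split) auto
    moreover have "\<phi> (real n + 1 - s) (\<phi> s x) \<in> W"
      using W'(3)[of "\<phi> s x" "real n + 1 - s"] s \<open>x \<in> X\<close> flow_in by auto
    ultimately show ?thesis
      using flow_in[of "real n + 1" x] \<open>x \<in> X\<close> by auto
  qed
  moreover have "W \<inter> X \<subseteq> top_of_set X interior_of U"
    using WU W(1) by (intro interior_of_maximal) (auto simp: openin_open)
  ultimately have "\<phi> (real n + 1) ` (top_of_set X closure_of U) \<subseteq> top_of_set X interior_of U"
    using closure_of_carrier[OF \<open>U \<subseteq> X\<close>] clU by auto
  moreover have "real n + 1 \<in> T" "0 < real n + 1" by auto
  ultimately have "trapping_region T X \<phi> U"
    using U unfolding trapping_region_def by blast
  moreover have "A = Inv T X \<phi> U"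
  proof
    show "A \<subseteq> Inv T X \<phi> U"
      using W(2) WU A by (intro Inv_greatest) auto
    show "Inv T X \<phi> U \<subseteq> A"
    proof (rule backward_image_subset_attractor[OF AR])
      show "Inv T X \<phi> U \<subseteq> X" using Inv_subset \<open>U \<subseteq> X\<close> by blast
      show "Inv T X \<phi> U \<subseteq> \<phi> 1 ` Inv T X \<phi> U"
        using invariantD[OF invariant_Inv, of 1 U] by simp
      have "closure (Inv T X \<phi> U) \<subseteq> U"
        using clU Inv_subset by (simp add: closure_minimal)
      then show "closure (Inv T X \<phi> U) \<inter> R = {}"
        using U_clV clV by blast
    qed
  qed
  ultimately show ?thesis unfolding attractor_def by blast
qed

section \<open>The equivalence\<close>

lemma separated_by_limits_dual_repeller:
  assumes "attractor T X \<phi> A"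
  shows "separated_by_limits A (dual_repeller T X \<phi> A)"
proof -
  define U where "U = (SOME U. trapping_region T X \<phi> U \<and> A = Inv T X \<phi> U)"
  have "trapping_region T X \<phi> U \<and> A = Inv T X \<phi> U"
    using assms unfolding attractor_def U_def by (rule someI_ex)
  then show ?thesis
    using separated_by_limits_trapping_region[of U] unfolding dual_repeller_def U_def by simp
qed

text \<open>In the converse, \<open>A\<close> is already an attractor, so its dual repeller also
  satisfies the limit conditions with \<open>A\<close>; uniqueness identifies it with
  \<open>R\<close>.\<close>

lemma attractor_repeller_pair_iff:
  "attractor_repeller_pair T X \<phi> A R \<longleftrightarrow> separated_by_limits A R"
proof
  assume "attractor_repeller_pair T X \<phi> A R"
  then show "separated_by_limits A R"
    using separated_by_limits_dual_repeller by (simp add: attractor_repeller_pair_def)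
next
  assume AR: "separated_by_limits A R"
  then have A: "attractor T X \<phi> A" by (rule attractor_if_separated_by_limits)
  then have "R = dual_repeller T X \<phi> A"
    using AR separated_by_limits_dual_repeller separated_by_limits_repeller_subset by blast
  with A show "attractor_repeller_pair T X \<phi> A R" by (simp add: attractor_repeller_pair_def)
qed

end

theorem theorem3p19:
  fixes T :: "real set"
    and X :: "'a::metric_space set"
    and \<phi> :: "real \<Rightarrow> 'a \<Rightarrow> 'a"
    and A R :: "'a set"
  assumes "T = \<int> \<or> T = UNIV"
    and "compact X"
    and "dynamical_system T X \<phi>"
    and "A \<subseteq> X"
    and "R \<subseteq> X"
  shows "attractor_repeller_pair T X \<phi> A R \<longleftrightarrow>
    A \<inter> R = {} \<and> compact A \<and> compact R \<and>
    invariant T X \<phi> A \<and> forward_invariant T X \<phi> R \<and>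
    (\<forall>x \<in> X - (A \<union> R).
      omega_limit T X \<phi> x \<subseteq> A \<and>
      (\<forall>\<gamma>. backward_orbit T X \<phi> x \<gamma> \<longrightarrow> orbital_alpha_limit T X \<gamma> \<subseteq> R))"
proof -
  interpret compact_semiflow T X \<phi>
    using assms by unfold_locales
  show ?thesis
    using attractor_repeller_pair_iff unfolding separated_by_limits_def .
qed

end
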